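(* Let $P=P_1|P_2$ be an unrestricted XCCS process. Then $P\leftrightarrow\overline{P}$ for some XCCS process $\overline{P}$ with no occurrence of the $|$ operator, where $P\leftrightarrow Q$ means $\vdash\langle P\rangle p\leftrightarrow\langle Q\rangle p$ in the XCCS-PDL axiom system.
   Context: XCCS processes: $P ::= {\bf 0}\mid END\mid\alpha.P\mid P_1;P_2\mid P_1+P_2\mid P_1|P_2\mid P^*\mid P\backslash L$ ($\alpha ::= a\mid\overline a\mid\tau$; successful termination $\mathrm{Done}$ only via the ending action $END$); unrestricted means no occurrence of $\backslash$. XCCS-PDL axiom system: propositional tautologies, (K), (Du), Substitution, Modus Ponens, Generalization; (Pr) $\langle\alpha.P\rangle p\leftrightarrow\langle\alpha\rangle\langle P\rangle p$; (NC) $\langle P_1+P_2\rangle p\leftrightarrow\langle P_1\rangle p\lor\langle P_2\rangle p$; (PC) if $P=P_1|P_2$ is unrestricted and $|$ does not occur in $P_1,P_2$, then $\langle P\rangle p\leftrightarrow\langle Exp(P)\rangle p$, with $Exp(P)=\sum_{P_1\stackrel{\alpha}{\to}P_1'}\alpha.(P_1'|P_2)+\sum_{P_2\stackrel{\beta}{\to}P_2'}\beta.(P_1|P_2')+\sum\tau.(P_1'|P_2')+E_P$ (third sum over complementary pairs; $E_P=END$ if both $P_i$ can do $END$ to $\mathrm{Done}$, else ${\bf 0}$); (0) $\neg\langle{\bf 0}\rangle p$; (END) $\langle END\rangle p\leftrightarrow p$; (SC) $\langle P_1;P_2\rangle p\leftrightarrow\langle P_1\rangle\langle P_2\rangle p$;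 (Rec) $\langle P^*\rangle p\leftrightarrow p\lor\langle P\rangle\langle P^*\rangle p$; (FP) $p\land[P^*](p\to[P]p)\to[P^*]p$; (PCSub)/(RSub) congruence rules for $|R$ and $\backslash L$; (Ard) if $\vdash\langle P\rangle p\leftrightarrow\langle A;P+B\rangle p$ and $A$ cannot do $END$ to $\mathrm{Done}$, then $\vdash\langle P\rangle p\leftrightarrow\langle A^*;B\rangle p$; (Con) r-congruent processes are provably equivalent. The relation $\leftrightarrow$ is known to be a congruence. *)

theory Defs
  imports Main
begin

section \<open>XCCS processes\<close>

datatype 'a act = In 'a | Out 'a | Tau

fun compl :: "'a act \<Rightarrow> 'a act" where
  "compl (In a) = Out a"
| "compl (Out a) = In a"
| "compl Tau = Tau"

datatype 'a proc =
    Zero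
  | END
  | Pre "'a act" "'a proc"
  | Seq "'a proc" "'a proc"
  | Sum "'a proc" "'a proc"
  | Par "'a proc" "'a proc"
  | Star "'a proc"
  | Res "'a proc" "'a set"

fun unrestricted :: "'a proc \<Rightarrow> bool" where
  "unrestricted Zero = True"
| "unrestricted END = True"
| "unrestricted (Pre \<alpha> P) = unrestricted P"
| "unrestricted (Seq P Q) = (unrestricted P \<and> unrestricted Q)"
| "unrestricted (Sum P Q) = (unrestricted P \<and> unrestricted Q)"
| "unrestricted (Par P Q) = (unrestricted P \<and> unrestricted Q)"
| "unrestricted (Star P) = unrestricted P"
| "unrestricted (Res P L) = False"

fun par_free :: "'a proc \<Rightarrow> bool" where
  "par_free Zero = True"
| "par_free END = True"
| "par_free (Pre \<alpha> P) = par_free P"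
| "par_free (Seq P Q) = (par_free P \<and> par_free Q)"
| "par_free (Sum P Q) = (par_free P \<and> par_free Q)"
| "par_free (Par P Q) = False"
| "par_free (Star P) = par_free P"
| "par_free (Res P L) = par_free P"


section \<open>Transitions\<close>

text \<open>The successfully terminated state \<open>Done\<close> is not a process, and the ending action \<open>Ending\<close>
  is not one of the prefixes \<open>\<alpha>\<close>: it labels exactly the transitions into \<open>Done\<close>.\<close>

datatype 'a label = Act "'a act" | Ending

datatype 'a state = Proc "'a proc" | Done

fun restricted_by :: "'a set \<Rightarrow> 'a act \<Rightarrow> bool" where
  "restricted_by L (In a) = (a \<in> L)"
| "restricted_by L (Out a) = (a \<in> L)"
| "restricted_by L Tau = False"

text \<open>The ending action of the left component of a sequential composition is silent (the
  composition takes the first step of the right component instead), and \<open>P|Q\<close> ends only when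
  both components end; this is what (END), (SC) and the summand \<open>E\<^sub>P\<close> of the expansion require.\<close>

inductive step :: "'a proc \<Rightarrow> 'a label \<Rightarrow> 'a state \<Rightarrow> bool"  ("_ \<midarrow>_\<rightarrow> _" [61, 0, 61] 60) where
  step_END:  "END \<midarrow>Ending\<rightarrow> Done"
| step_Pre:  "Pre \<alpha> P \<midarrow>Act \<alpha>\<rightarrow> Proc P"
| step_Sum1: "P \<midarrow>l\<rightarrow> s \<Longrightarrow> Sum P Q \<midarrow>l\<rightarrow> s"
| step_Sum2: "Q \<midarrow>l\<rightarrow> s \<Longrightarrow> Sum P Q \<midarrow>l\<rightarrow> s"
| step_Seq1: "P \<midarrow>Act \<alpha>\<rightarrow> Proc P' \<Longrightarrow> Seq P Q \<midarrow>Act \<alpha>\<rightarrow> Proc (Seq P' Q)"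
| step_Seq2: "P \<midarrow>Ending\<rightarrow> Done \<Longrightarrow> Q \<midarrow>l\<rightarrow> s \<Longrightarrow> Seq P Q \<midarrow>l\<rightarrow> s"
| step_Par1: "P \<midarrow>Act \<alpha>\<rightarrow> Proc P' \<Longrightarrow> Par P Q \<midarrow>Act \<alpha>\<rightarrow> Proc (Par P' Q)"
| step_Par2: "Q \<midarrow>Act \<alpha>\<rightarrow> Proc Q' \<Longrightarrow> Par P Q \<midarrow>Act \<alpha>\<rightarrow> Proc (Par P Q')"
| step_Com:  "P \<midarrow>Act \<alpha>\<rightarrow> Proc P' \<Longrightarrow> Q \<midarrow>Act (compl \<alpha>)\<rightarrow> Proc Q' \<Longrightarrow> \<alpha> \<noteq> Tau
               \<Longrightarrow> Par P Q \<midarrow>Act Tau\<rightarrow> Proc (Par P' Q')"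
| step_ParE: "P \<midarrow>Ending\<rightarrow> Done \<Longrightarrow> Q \<midarrow>Ending\<rightarrow> Done \<Longrightarrow> Par P Q \<midarrow>Ending\<rightarrow> Done"
| step_Star: "P \<midarrow>Act \<alpha>\<rightarrow> Proc P' \<Longrightarrow> Star P \<midarrow>Act \<alpha>\<rightarrow> Proc (Seq P' (Star P))"
| step_StarE: "Star P \<midarrow>Ending\<rightarrow> Done"
| step_Res:  "P \<midarrow>Act \<alpha>\<rightarrow> Proc P' \<Longrightarrow> \<not> restricted_by L \<alpha> \<Longrightarrow> Res P L \<midarrow>Act \<alpha>\<rightarrow> Proc (Res P' L)"
| step_ResE: "P \<midarrow>Ending\<rightarrow> Done \<Longrightarrow> Res P L \<midarrow>Ending\<rightarrow> Done"


section \<open>Expansion\<close>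

text \<open>The sum of a finite set of processes, in an unspecified order; the empty sum is \<open>Zero\<close>.
  By \<open>finite_step\<close> below, it is applied to finite sets only.\<close>

definition set_sum :: "'a proc set \<Rightarrow> 'a proc" where
  "set_sum A = foldr Sum (SOME Ps. distinct Ps \<and> set Ps = A) Zero"

definition Exp :: "'a proc \<Rightarrow> 'a proc \<Rightarrow> 'a proc" where
  "Exp P1 P2 =
     Sum (set_sum {Pre \<alpha> (Par P1' P2) | \<alpha> P1'. P1 \<midarrow>Act \<alpha>\<rightarrow> Proc P1'})
    (Sum (set_sum {Pre \<beta> (Par P1 P2') | \<beta> P2'. P2 \<midarrow>Act \<beta>\<rightarrow> Proc P2'})
    (Sum (set_sum {Pre Tau (Par P1' P2') | \<alpha> P1' P2'.
                     \<alpha> \<noteq> Tau \<and> P1 \<midarrow>Act \<alpha>\<rightarrow> Proc P1' \<and> P2 \<midarrow>Act (compl \<alpha>)\<rightarrow> Proc P2'})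
         (if P1 \<midarrow>Ending\<rightarrow> Done \<and> P2 \<midarrow>Ending\<rightarrow> Done then END else Zero)))"

inductive_cases step_elims:
  "Zero \<midarrow>l\<rightarrow> s" "END \<midarrow>l\<rightarrow> s" "Pre \<alpha> P \<midarrow>l\<rightarrow> s" "Sum P Q \<midarrow>l\<rightarrow> s" "Seq P Q \<midarrow>l\<rightarrow> s"
  "Par P Q \<midarrow>l\<rightarrow> s" "Star P \<midarrow>l\<rightarrow> s" "Res P L \<midarrow>l\<rightarrow> s"

lemma finite_step: "finite {(\<alpha>, P'). P \<midarrow>Act \<alpha>\<rightarrow> Proc P'}" (is "finite (?S P)")
proof (induction P)
  case Zero
  have "?S Zero \<subseteq> {}"
    by (auto elim: step_elims)
  then show ?case by (rule finite_subset) simp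
next
  case END
  have "?S END \<subseteq> {}"
    by (auto elim: step_elims)
  then show ?case by (rule finite_subset) simp
next
  case (Pre \<alpha> P)
  have "?S (Pre \<alpha> P) \<subseteq> {(\<alpha>, P)}"
    by (auto elim: step_elims)
  then show ?case by (rule finite_subset) simp
next
  case (Seq P Q)
  have "?S (Seq P Q) \<subseteq> map_prod id (\<lambda>P'. Seq P' Q) ` ?S P \<union> ?S Q"
    by (clarsimp, erule step_elims) (auto intro: rev_image_eqI)
  then show ?case by (rule finite_subset) (use Seq in simp)
next
  case (Sum P Q)
  have "?S (Sum P Q) \<subseteq> ?S P \<union> ?S Q"
    by (auto elim: step_elims)
  then show ?case by (rule finite_subset) (use Sum in simp)
next
  case (Par P Q)
  have "?S (Par P Q) \<subseteq> map_prod id (\<lambda>P'. Par P' Q) ` ?S P \<union> map_prod id (Par P) ` ?S Q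
          \<union> (\<Union>x\<in>?S P. \<Union>y\<in>?S Q. {(Tau, Par (snd x) (snd y))})"
      (is "_ \<subseteq> ?A")
  proof
    fix x assume "x \<in> ?S (Par P Q)"
    then obtain \<alpha> R where x: "x = (\<alpha>, R)" and "Par P Q \<midarrow>Act \<alpha>\<rightarrow> Proc R" by auto
    from this(2) show "x \<in> ?A"
      by cases (use x in \<open>force simp: image_iff\<close>)+
  qed
  then show ?case by (rule finite_subset) (use Par in simp)
next
  case (Star P)
  have "?S (Star P) \<subseteq> map_prod id (\<lambda>P'. Seq P' (Star P)) ` ?S P"
    by (clarsimp, erule step_elims) (auto intro: rev_image_eqI)
  then show ?case by (rule finite_subset) (use Star in simp)
next
  case (Res P L)
  have "?S (Res P L) \<subseteq> map_prod id (\<lambda>P'. Res P' L) ` ?S P"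
    by (clarsimp, erule step_elims) (auto intro: rev_image_eqI)
  then show ?case by (rule finite_subset) (use Res in simp)
qed


section \<open>Formulas\<close>

datatype 'a modality = Basic "'a act" | Prog "'a proc"

datatype 'a fm =
    Var nat
  | Top
  | Neg "'a fm"
  | Conj "'a fm" "'a fm"
  | Dia "'a modality" "'a fm"

abbreviation Disj :: "'a fm \<Rightarrow> 'a fm \<Rightarrow> 'a fm" where
  "Disj f g \<equiv> Neg (Conj (Neg f) (Neg g))"

abbreviation Imp :: "'a fm \<Rightarrow> 'a fm \<Rightarrow> 'a fm" where
  "Imp f g \<equiv> Neg (Conj f (Neg g))"

abbreviation Iff :: "'a fm \<Rightarrow> 'a fm \<Rightarrow> 'a fm" where
  "Iff f g \<equiv> Conj (Imp f g) (Imp g f)"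

abbreviation Box :: "'a modality \<Rightarrow> 'a fm \<Rightarrow> 'a fm" where
  "Box m f \<equiv> Neg (Dia m (Neg f))"

text \<open>A tautology is true under every Boolean valuation \<open>v\<close> of its propositionally atomic
  subformulas, i.e. letters and diamond formulas.\<close>

fun prop_eval :: "('a fm \<Rightarrow> bool) \<Rightarrow> 'a fm \<Rightarrow> bool" where
  "prop_eval v (Var p) = v (Var p)"
| "prop_eval v Top = True"
| "prop_eval v (Neg f) = (\<not> prop_eval v f)"
| "prop_eval v (Conj f g) = (prop_eval v f \<and> prop_eval v g)"
| "prop_eval v (Dia m f) = v (Dia m f)"

definition tautology :: "'a fm \<Rightarrow> bool" where
  "tautology f \<longleftrightarrow> (\<forall>v. prop_eval v f)"

fun subst :: "(nat \<Rightarrow> 'a fm) \<Rightarrow> 'a fm \<Rightarrow> 'a fm" where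
  "subst \<sigma> (Var p) = \<sigma> p"
| "subst \<sigma> Top = Top"
| "subst \<sigma> (Neg f) = Neg (subst \<sigma> f)"
| "subst \<sigma> (Conj f g) = Conj (subst \<sigma> f) (subst \<sigma> g)"
| "subst \<sigma> (Dia m f) = Dia m (subst \<sigma> f)"


section \<open>The axiom system\<close>

text \<open>
  In the axioms and rules, \<open>p\<close> and \<open>q\<close> are propositional letters, not arbitrary formulas; general
  instances come from the substitution rule. The rules with an equivalence as premise rely on this:
  \<open>PCSub1\<close> and \<open>PCSub2\<close>, for instance, would be unsound with \<open>Top\<close> in place of \<open>Var p\<close>.

  The relation used by \<open>Con\<close> is a parameter \<open>rcong\<close> of the system, to be instantiated with
  r-congruence.
\<close>

inductive derivable :: "('a proc \<Rightarrow> 'a proc \<Rightarrow> bool) \<Rightarrow> 'a fm \<Rightarrow> bool"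
  for rcong :: "'a proc \<Rightarrow> 'a proc \<Rightarrow> bool" where
  Taut:  "tautology f \<Longrightarrow> derivable rcong f"
| K:     "derivable rcong (Imp (Box m (Imp (Var p) (Var q))) (Imp (Box m (Var p)) (Box m (Var q))))"
| Du:    "derivable rcong (Iff (Dia m (Var p)) (Neg (Box m (Neg (Var p)))))"
| Subst: "derivable rcong f \<Longrightarrow> derivable rcong (subst \<sigma> f)"
| MP:    "derivable rcong (Imp f g) \<Longrightarrow> derivable rcong f \<Longrightarrow> derivable rcong g"
| Gen:   "derivable rcong f \<Longrightarrow> derivable rcong (Box m f)"
| Pr:    "derivable rcong (Iff (Dia (Prog (Pre \<alpha> P)) (Var p)) (Dia (Basic \<alpha>) (Dia (Prog P) (Var p))))"
| NC:    "derivable rcong (Iff (Dia (Prog (Sum P Q)) (Var p))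
                               (Disj (Dia (Prog P) (Var p)) (Dia (Prog Q) (Var p))))"
| PC:    "unrestricted (Par P Q) \<Longrightarrow> par_free P \<Longrightarrow> par_free Q \<Longrightarrow>
          derivable rcong (Iff (Dia (Prog (Par P Q)) (Var p)) (Dia (Prog (Exp P Q)) (Var p)))"
| ZeroA: "derivable rcong (Neg (Dia (Prog Zero) (Var p)))"
| ENDA:  "derivable rcong (Iff (Dia (Prog END) (Var p)) (Var p))"
| SC:    "derivable rcong (Iff (Dia (Prog (Seq P Q)) (Var p)) (Dia (Prog P) (Dia (Prog Q) (Var p))))"
| Rec:   "derivable rcong (Iff (Dia (Prog (Star P)) (Var p))
                               (Disj (Var p) (Dia (Prog P) (Dia (Prog (Star P)) (Var p)))))"
| FP:    "derivable rcong (Imp (Conj (Var p) (Box (Prog (Star P)) (Imp (Var p) (Box (Prog P) (Var p)))))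
                               (Box (Prog (Star P)) (Var p)))"
| PCSub1: "derivable rcong (Iff (Dia (Prog P) (Var p)) (Dia (Prog Q) (Var p))) \<Longrightarrow>
           derivable rcong (Iff (Dia (Prog (Par P R)) (Var p)) (Dia (Prog (Par Q R)) (Var p)))"
| PCSub2: "derivable rcong (Iff (Dia (Prog P) (Var p)) (Dia (Prog Q) (Var p))) \<Longrightarrow>
           derivable rcong (Iff (Dia (Prog (Par R P)) (Var p)) (Dia (Prog (Par R Q)) (Var p)))"
| RSub:  "derivable rcong (Iff (Dia (Prog P) (Var p)) (Dia (Prog Q) (Var p))) \<Longrightarrow>
          derivable rcong (Iff (Dia (Prog (Res P L)) (Var p)) (Dia (Prog (Res Q L)) (Var p)))"
| Ard:   "derivable rcong (Iff (Dia (Prog P) (Var p)) (Dia (Prog (Sum (Seq A P) B)) (Var p))) \<Longrightarrow>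
          \<not> A \<midarrow>Ending\<rightarrow> Done \<Longrightarrow>
          derivable rcong (Iff (Dia (Prog P) (Var p)) (Dia (Prog (Seq (Star A) B)) (Var p)))"
| Con:   "rcong P Q \<Longrightarrow> derivable rcong (Iff (Dia (Prog P) (Var p)) (Dia (Prog Q) (Var p)))"

definition prov_equiv :: "('a proc \<Rightarrow> 'a proc \<Rightarrow> bool) \<Rightarrow> 'a proc \<Rightarrow> 'a proc \<Rightarrow> bool" where
  "prov_equiv rcong P Q \<longleftrightarrow>
     (\<forall>p. derivable rcong (Iff (Dia (Prog P) (Var p)) (Dia (Prog Q) (Var p))))"

end

theory Submission
  imports Defs
begin

text \<open>
  An unrestricted process without \<open>|\<close> has only finitely many derivatives, since these are
  partial derivatives of a regular expression. Hence the compositions of derivatives of two such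
  processes are finitely many, and by (PC) they satisfy a finite system of equations which is linear
  over the idempotent semiring of processes modulo provable equivalence. As every coefficient starts
  with a proper action, (Ard) solves the system by Gaussian elimination. Nested occurrences of \<open>|\<close>
  are removed from the inside out by congruence.
\<close>

section \<open>Propositional and modal reasoning\<close>

text \<open>Semantic form of propositional reasoning: once \<open>prop_eval\<close> confirms the
  entailment, \<open>Taut\<close> and \<open>MP\<close> do the rest. Diamond formulas count as atoms
  here.\<close>

lemma derivable_prop1:
  assumes "derivable rcong f" and "\<And>v. prop_eval v f \<Longrightarrow> prop_eval v g"
  shows "derivable rcong g"
proof -
  have "derivable rcong (Imp f g)"
    by (rule derivable.Taut) (use assms(2) in \<open>auto simp: tautology_def\<close>)
  then show ?thesis
    using assms(1) by (rule derivable.MP)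
qed

lemma derivable_conj:
  assumes "derivable rcong f" and "derivable rcong g"
  shows "derivable rcong (Conj f g)"
proof -
  have "derivable rcong (Imp f (Imp g (Conj f g)))"
    by (rule derivable.Taut) (auto simp: tautology_def)
  from derivable.MP[OF derivable.MP[OF this assms(1)] assms(2)] show ?thesis .
qed

lemma derivable_prop2:
  assumes "derivable rcong f" and "derivable rcong g"
    and "\<And>v. prop_eval v f \<Longrightarrow> prop_eval v g \<Longrightarrow> prop_eval v h"
  shows "derivable rcong h"
  by (rule derivable_prop1[OF derivable_conj[OF assms(1,2)]]) (use assms(3) in auto)

lemma derivable_prop3:
  assumes "derivable rcong f" and "derivable rcong g" and "derivable rcong h"
    and "\<And>v. prop_eval v f \<Longrightarrow> prop_eval v g \<Longrightarrow> prop_eval v h \<Longrightarrow> prop_eval v k"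
  shows "derivable rcong k"
  by (rule derivable_prop2[OF derivable_conj[OF assms(1,2)] assms(3)]) (use assms(4) in auto)

lemma derivable_K:
  "derivable rcong (Imp (Box m (Imp f g)) (Imp (Box m f) (Box m g)))"
  using derivable.Subst[OF derivable.K[of rcong m 0 1], of "\<lambda>p. if p = 0 then f else g"]
  by simp

lemma derivable_Du: "derivable rcong (Iff (Dia m f) (Neg (Box m (Neg f))))"
  using derivable.Subst[OF derivable.Du[of rcong m 0], of "\<lambda>p. f"] by simp

text \<open>Contraposition, \<open>Gen\<close> and \<open>K\<close> give the box form. As
  \<open>Box\<close> is defined by negations, this speaks of \<open>Dia m (Neg (Neg f))\<close>,
  propositionally a different atom from \<open>Dia m f\<close>; \<open>Du\<close> links the
  two.\<close>

lemma derivable_Dia_mono: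
  assumes "derivable rcong (Imp f g)"
  shows "derivable rcong (Imp (Dia m f) (Dia m g))"
proof -
  have "derivable rcong (Imp (Neg g) (Neg f))"
    by (rule derivable_prop1[OF assms]) auto
  from derivable.MP[OF derivable_K derivable.Gen[OF this]]
  have "derivable rcong (Imp (Box m (Neg g)) (Box m (Neg f)))" .
  then show ?thesis
    by (rule derivable_prop3[OF _ derivable_Du[of rcong m f] derivable_Du[of rcong m g]]) auto
qed

lemma derivable_Dia_cong:
  assumes "derivable rcong (Iff f g)"
  shows "derivable rcong (Iff (Dia m f) (Dia m g))"
  by (intro derivable_conj derivable_Dia_mono; rule derivable_prop1[OF assms]; auto)

text \<open>One half is monotonicity. The other is the contrapositive of \<open>K\<close> for
  \<open>Neg f\<close> and \<open>Neg (Disj f g)\<close>; \<open>K1\<close>, \<open>K2\<close> and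
  \<open>K3\<close> simplify the formulas under its diamonds.\<close>

lemma derivable_Dia_Disj:
  "derivable rcong (Iff (Dia m (Disj f g)) (Disj (Dia m f) (Dia m g)))"
proof -
  have f: "derivable rcong (Imp (Dia m f) (Dia m (Disj f g)))"
    by (rule derivable_Dia_mono, rule derivable.Taut) (auto simp: tautology_def)
  have g: "derivable rcong (Imp (Dia m g) (Dia m (Disj f g)))"
    by (rule derivable_Dia_mono, rule derivable.Taut) (auto simp: tautology_def)
  have K1: "derivable rcong (Imp (Dia m (Neg (Imp (Neg f) (Neg (Disj f g))))) (Dia m g))"
    by (rule derivable_Dia_mono, rule derivable.Taut) (auto simp: tautology_def)
  have K2: "derivable rcong (Imp (Dia m (Neg (Neg f))) (Dia m f))"
    by (rule derivable_Dia_mono, rule derivable.Taut) (auto simp: tautology_def)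
  have K3: "derivable rcong (Imp (Dia m (Disj f g)) (Dia m (Neg (Neg (Disj f g)))))"
    by (rule derivable_Dia_mono, rule derivable.Taut) (auto simp: tautology_def)
  have "derivable rcong (Imp (Dia m (Disj f g)) (Disj (Dia m f) (Dia m g)))"
    by (rule derivable_prop2[OF derivable_conj[OF K1 K2]
          derivable_conj[OF K3 derivable_K[of rcong m "Neg f" "Neg (Disj f g)"]]]) auto
  then show ?thesis
    by (rule derivable_prop3[OF f g]) auto
qed


section \<open>The semiring of processes modulo provable equivalence\<close>

lemma derivable_Iff_refl: "derivable rcong (Iff f f)"
  by (rule derivable.Taut) (auto simp: tautology_def)

lemma derivable_Iff_sym: "derivable rcong (Iff f g) \<Longrightarrow> derivable rcong (Iff g f)"
  by (erule derivable_prop1) auto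

lemma derivable_Iff_trans [trans]:
  "derivable rcong (Iff f g) \<Longrightarrow> derivable rcong (Iff g h) \<Longrightarrow> derivable rcong (Iff f h)"
  by (erule derivable_prop2) auto

lemma derivable_Disj_cong:
  "derivable rcong (Iff f f') \<Longrightarrow> derivable rcong (Iff g g') \<Longrightarrow>
    derivable rcong (Iff (Disj f g) (Disj f' g'))"
  by (erule derivable_prop2) auto

text \<open>Passes by \<open>Subst\<close> from letters to arbitrary formulas, so that an
  equivalence can be applied in front of another diamond, as in
  \<open>prov_equiv_Seq\<close>.\<close>

lemma prov_equivD:
  "prov_equiv rcong P Q \<Longrightarrow> derivable rcong (Iff (Dia (Prog P) f) (Dia (Prog Q) f))"
  unfolding prov_equiv_def
  using derivable.Subst[of rcong "Iff (Dia (Prog P) (Var 0)) (Dia (Prog Q) (Var 0))" "\<lambda>p. f"]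
  by simp

lemma prov_equivI:
  "(\<And>f. derivable rcong (Iff (Dia (Prog P) f) (Dia (Prog Q) f))) \<Longrightarrow> prov_equiv rcong P Q"
  by (simp add: prov_equiv_def)

lemma prov_equiv_refl: "prov_equiv rcong P P"
  by (rule prov_equivI, rule derivable_Iff_refl)

lemma prov_equiv_sym: "prov_equiv rcong P Q \<Longrightarrow> prov_equiv rcong Q P"
  by (rule prov_equivI, rule derivable_Iff_sym, rule prov_equivD)

lemma prov_equiv_trans [trans]:
  "prov_equiv rcong P Q \<Longrightarrow> prov_equiv rcong Q R \<Longrightarrow> prov_equiv rcong P R"
  by (rule prov_equivI, rule derivable_Iff_trans; rule prov_equivD)

section \<open>Instances of the process axioms for arbitrary formulas\<close>

lemma derivable_Pre:
  "derivable rcong (Iff (Dia (Prog (Pre \<alpha> P)) f) (Dia (Basic \<alpha>) (Dia (Prog P) f)))"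
  using derivable.Subst[OF derivable.Pr[of rcong \<alpha> P 0], of "\<lambda>p. f"] by simp

lemma derivable_Sum:
  "derivable rcong (Iff (Dia (Prog (Sum P Q)) f) (Disj (Dia (Prog P) f) (Dia (Prog Q) f)))"
  using derivable.Subst[OF derivable.NC[of rcong P Q 0], of "\<lambda>p. f"] by simp

lemma derivable_Seq:
  "derivable rcong (Iff (Dia (Prog (Seq P Q)) f) (Dia (Prog P) (Dia (Prog Q) f)))"
  using derivable.Subst[OF derivable.SC[of rcong P Q 0], of "\<lambda>p. f"] by simp

lemma derivable_END: "derivable rcong (Iff (Dia (Prog END) f) f)"
  using derivable.Subst[OF derivable.ENDA[of rcong 0], of "\<lambda>p. f"] by simp

lemma derivable_Zero: "derivable rcong (Neg (Dia (Prog Zero) f))"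
  using derivable.Subst[OF derivable.ZeroA[of rcong 0], of "\<lambda>p. f"] by simp

lemma derivable_Star:
  "derivable rcong (Iff (Dia (Prog (Star P)) f) (Disj f (Dia (Prog P) (Dia (Prog (Star P)) f))))"
  using derivable.Subst[OF derivable.Rec[of rcong P 0], of "\<lambda>p. f"] by simp

lemma derivable_FP:
  "derivable rcong (Imp (Conj f (Box (Prog (Star P)) (Imp f (Box (Prog P) f)))) (Box (Prog (Star P)) f))"
  using derivable.Subst[OF derivable.FP[of rcong 0 P], of "\<lambda>p. f"] by simp

section \<open>Congruence of the operators\<close>

lemma prov_equiv_Pre:
  assumes "prov_equiv rcong P Q"
  shows "prov_equiv rcong (Pre \<alpha> P) (Pre \<alpha> Q)"
proof (rule prov_equivI)
  fix f
  note derivable_Pre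
  also note derivable_Dia_cong[OF prov_equivD[OF assms]]
  also note derivable_Iff_sym[OF derivable_Pre]
  finally show "derivable rcong (Iff (Dia (Prog (Pre \<alpha> P)) f) (Dia (Prog (Pre \<alpha> Q)) f))" .
qed

lemma prov_equiv_Sum:
  assumes "prov_equiv rcong P P'" and "prov_equiv rcong Q Q'"
  shows "prov_equiv rcong (Sum P Q) (Sum P' Q')"
proof (rule prov_equivI)
  fix f
  note derivable_Sum
  also note derivable_Disj_cong[OF prov_equivD[OF assms(1)] prov_equivD[OF assms(2)]]
  also note derivable_Iff_sym[OF derivable_Sum]
  finally show "derivable rcong (Iff (Dia (Prog (Sum P Q)) f) (Dia (Prog (Sum P' Q')) f))" .
qed

lemma prov_equiv_Seq:
  assumes "prov_equiv rcong P P'" and "prov_equiv rcong Q Q'"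
  shows "prov_equiv rcong (Seq P Q) (Seq P' Q')"
proof (rule prov_equivI)
  fix f
  note derivable_Seq
  also note derivable_Dia_cong[OF prov_equivD[OF assms(2)]]
  also note prov_equivD[OF assms(1)]
  also note derivable_Iff_sym[OF derivable_Seq]
  finally show "derivable rcong (Iff (Dia (Prog (Seq P Q)) f) (Dia (Prog (Seq P' Q')) f))" .
qed

text \<open>Induction by \<open>FP\<close> with the invariant \<open>Neg g\<close>, where
  \<open>g\<close> is the diamond of \<open>Star Q\<close>. By \<open>Rec\<close>, \<open>g\<close>
  follows from \<open>Dia (Prog Q) g\<close>, hence from \<open>Dia (Prog P) g\<close>; so
  \<open>Neg g\<close> is preserved by \<open>P\<close>. Also \<open>f\<close> implies
  \<open>g\<close>, and monotonicity concludes.\<close>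

lemma derivable_Star_mono:
  assumes "prov_equiv rcong P Q"
  shows "derivable rcong (Imp (Dia (Prog (Star P)) f) (Dia (Prog (Star Q)) f))"
proof -
  define g where "g = Dia (Prog (Star Q)) f"
  have unfold: "derivable rcong (Iff g (Disj f (Dia (Prog Q) g)))"
    unfolding g_def by (rule derivable_Star)
  have PQ: "derivable rcong (Iff (Dia (Prog P) g) (Dia (Prog Q) g))"
    by (rule prov_equivD[OF assms])
  have "derivable rcong (Imp (Dia (Prog P) (Neg (Neg g))) (Dia (Prog P) g))"
    by (rule derivable_Dia_mono, rule derivable.Taut) (auto simp: tautology_def)
  then have "derivable rcong (Imp (Neg g) (Box (Prog P) (Neg g)))"
    by (rule derivable_prop3[OF _ PQ unfold]) auto
  from derivable.Gen[OF this]
  have inv: "derivable rcong (Imp (Neg g) (Box (Prog (Star P)) (Neg g)))"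
    by (rule derivable_prop2[OF _ derivable_FP[of rcong "Neg g" P]]) auto
  have "derivable rcong (Imp f (Neg (Neg g)))"
    by (rule derivable_prop1[OF unfold]) auto
  from derivable_Dia_mono[OF this]
  have "derivable rcong (Imp (Dia (Prog (Star P)) f) g)"
    by (rule derivable_prop2[OF _ inv]) auto
  then show ?thesis unfolding g_def .
qed

lemma prov_equiv_Star: "prov_equiv rcong P Q \<Longrightarrow> prov_equiv rcong (Star P) (Star Q)"
  by (rule prov_equivI, rule derivable_conj; rule derivable_Star_mono)
    (assumption | erule prov_equiv_sym)+

lemma prov_equiv_Par:
  assumes "prov_equiv rcong P P'" and "prov_equiv rcong Q Q'"
  shows "prov_equiv rcong (Par P Q) (Par P' Q')"
proof (rule prov_equiv_trans)
  show "prov_equiv rcong (Par P Q) (Par P' Q)"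
    using assms(1) by (simp add: prov_equiv_def derivable.PCSub1)
  show "prov_equiv rcong (Par P' Q) (Par P' Q')"
    using assms(2) by (simp add: prov_equiv_def derivable.PCSub2)
qed

section \<open>Semiring laws and Arden's rule\<close>

lemma prov_equiv_Zero_Sum: "prov_equiv rcong (Sum Zero P) P"
proof (rule prov_equivI)
  fix f
  show "derivable rcong (Iff (Dia (Prog (Sum Zero P)) f) (Dia (Prog P) f))"
    by (rule derivable_prop2[OF derivable_Sum[of rcong Zero P f] derivable_Zero[of rcong f]]) auto
qed

lemma prov_equiv_Sum_Zero: "prov_equiv rcong (Sum P Zero) P"
proof (rule prov_equivI)
  fix f
  show "derivable rcong (Iff (Dia (Prog (Sum P Zero)) f) (Dia (Prog P) f))"
    by (rule derivable_prop2[OF derivable_Sum[of rcong P Zero f] derivable_Zero[of rcong f]]) auto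
qed

lemma prov_equiv_Zero_Seq: "prov_equiv rcong (Seq Zero P) Zero"
proof (rule prov_equivI)
  fix f
  show "derivable rcong (Iff (Dia (Prog (Seq Zero P)) f) (Dia (Prog Zero) f))"
    by (rule derivable_prop3[OF derivable_Seq[of rcong Zero P f] derivable_Zero[of rcong f]
          derivable_Zero[of rcong "Dia (Prog P) f"]]) auto
qed

lemma prov_equiv_Seq_assoc: "prov_equiv rcong (Seq (Seq P Q) R) (Seq P (Seq Q R))"
proof (rule prov_equivI)
  fix f
  note derivable_Seq
  also note derivable_Seq
  also note derivable_Iff_sym[OF derivable_Dia_cong[OF derivable_Seq]]
  also note derivable_Iff_sym[OF derivable_Seq]
  finally show "derivable rcong (Iff (Dia (Prog (Seq (Seq P Q) R)) f) (Dia (Prog (Seq P (Seq Q R))) f))" .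
qed

lemma prov_equiv_Seq_Sum: "prov_equiv rcong (Seq P (Sum Q R)) (Sum (Seq P Q) (Seq P R))"
proof (rule prov_equivI)
  fix f
  note derivable_Seq
  also note derivable_Dia_cong[OF derivable_Sum]
  also note derivable_Dia_Disj
  also note derivable_Iff_sym[OF derivable_Disj_cong[OF derivable_Seq derivable_Seq]]
  also note derivable_Iff_sym[OF derivable_Sum]
  finally show "derivable rcong
    (Iff (Dia (Prog (Seq P (Sum Q R))) f) (Dia (Prog (Sum (Seq P Q) (Seq P R))) f))" .
qed

lemma prov_equiv_Sum_Seq: "prov_equiv rcong (Seq (Sum P Q) R) (Sum (Seq P R) (Seq Q R))"
proof (rule prov_equivI)
  fix f
  note derivable_Seq
  also note derivable_Sum
  also note derivable_Iff_sym[OF derivable_Disj_cong[OF derivable_Seq derivable_Seq]]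
  also note derivable_Iff_sym[OF derivable_Sum]
  finally show "derivable rcong
    (Iff (Dia (Prog (Seq (Sum P Q) R)) f) (Dia (Prog (Sum (Seq P R) (Seq Q R))) f))" .
qed

lemma prov_equiv_Sum_interchange:
  "prov_equiv rcong (Sum (Sum P Q) (Sum R S)) (Sum (Sum P R) (Sum Q S))"
proof (rule prov_equivI)
  fix f
  note derivable_Sum
  also note derivable_Disj_cong[OF derivable_Sum derivable_Sum]
  also have "derivable rcong (Iff
      (Disj (Disj (Dia (Prog P) f) (Dia (Prog Q) f)) (Disj (Dia (Prog R) f) (Dia (Prog S) f)))
      (Disj (Disj (Dia (Prog P) f) (Dia (Prog R) f)) (Disj (Dia (Prog Q) f) (Dia (Prog S) f))))"
    by (rule derivable.Taut) (auto simp: tautology_def)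
  also note derivable_Iff_sym[OF derivable_Disj_cong[OF derivable_Sum derivable_Sum]]
  also note derivable_Iff_sym[OF derivable_Sum]
  finally show "derivable rcong
    (Iff (Dia (Prog (Sum (Sum P Q) (Sum R S))) f) (Dia (Prog (Sum (Sum P R) (Sum Q S))) f))" .
qed

lemma prov_equiv_Pre_Seq: "prov_equiv rcong (Pre \<alpha> P) (Seq (Pre \<alpha> END) P)"
proof (rule prov_equivI)
  fix f
  note derivable_Pre
  also note derivable_Iff_sym[OF derivable_Dia_cong[OF derivable_END]]
  also note derivable_Iff_sym[OF derivable_Pre]
  also note derivable_Iff_sym[OF derivable_Seq]
  finally show "derivable rcong (Iff (Dia (Prog (Pre \<alpha> P)) f) (Dia (Prog (Seq (Pre \<alpha> END) P)) f))" .
qed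

lemma prov_equiv_Ard:
  "prov_equiv rcong P (Sum (Seq A P) B) \<Longrightarrow> \<not> A \<midarrow>Ending\<rightarrow> Done \<Longrightarrow>
    prov_equiv rcong P (Seq (Star A) B)"
  by (simp add: prov_equiv_def derivable.Ard)


section \<open>Solving linear systems\<close>

text \<open>In effect the regular expressions, with prefixes as letters and \<open>END\<close> as
  unit. Both conjuncts are side conditions of \<open>PC\<close> on the components.\<close>

definition regular :: "'a proc \<Rightarrow> bool" where
  "regular P \<longleftrightarrow> par_free P \<and> unrestricted P"

lemma regular_simps [simp]:
  "regular Zero" "regular END"
  "regular (Pre \<alpha> P) \<longleftrightarrow> regular P"
  "regular (Seq P Q) \<longleftrightarrow> regular P \<and> regular Q"
  "regular (Sum P Q) \<longleftrightarrow> regular P \<and> regular Q"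
  "regular (Star P) \<longleftrightarrow> regular P"
  by (auto simp: regular_def)

text \<open>Right-hand sides of linear equations whose unknowns are the processes in
  \<open>V\<close>. A member of \<open>V\<close> is not linear in \<open>V\<close> by itself, since
  the coefficient \<open>END\<close> is excluded: for \<open>X\<close> in \<open>V\<close>,
  linearity expresses a guarded equation for \<open>X\<close>. Closure under equivalence avoids
  normal forms.\<close>

inductive linear_in :: "('a proc \<Rightarrow> 'a proc \<Rightarrow> bool) \<Rightarrow> 'a proc set \<Rightarrow> 'a proc \<Rightarrow> bool"
  for rcong :: "'a proc \<Rightarrow> 'a proc \<Rightarrow> bool" and V :: "'a proc set" where
  const: "regular B \<Longrightarrow> linear_in rcong V B"
| var:   "X \<in> V \<Longrightarrow> regular A \<Longrightarrow> \<not> A \<midarrow>Ending\<rightarrow> Done \<Longrightarrow> linear_in rcong V (Seq A X)"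
| sum:   "linear_in rcong V P \<Longrightarrow> linear_in rcong V Q \<Longrightarrow> linear_in rcong V (Sum P Q)"
| equiv: "linear_in rcong V P \<Longrightarrow> prov_equiv rcong Q P \<Longrightarrow> linear_in rcong V Q"

text \<open>\<open>C\<close> may end, but \<open>Seq C A\<close> ends only if \<open>A\<close> does,
  so the new coefficients stay guarded.\<close>

lemma linear_in_Seq:
  assumes "linear_in rcong V P" and "regular C"
  shows "linear_in rcong V (Seq C P)"
  using assms(1)
proof induction
  case (const B)
  with assms(2) show ?case by (simp add: linear_in.const)
next
  case (var X A)
  then have "linear_in rcong V (Seq (Seq C A) X)"
    using assms(2) by (intro linear_in.var) (auto elim: step_elims)
  then show ?case
    by (rule linear_in.equiv) (rule prov_equiv_sym[OF prov_equiv_Seq_assoc])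
next
  case (sum P Q)
  then show ?case
    by (meson linear_in.equiv linear_in.sum prov_equiv_Seq_Sum)
next
  case (equiv P Q)
  then show ?case
    by (meson linear_in.equiv prov_equiv_Seq prov_equiv_refl)
qed

text \<open>Collects all occurrences of \<open>X\<close> into one coefficient, giving the shape that
  \<open>Ard\<close> requires. A sum of coefficients that cannot end cannot end either.\<close>

lemma linear_in_insertE:
  assumes "linear_in rcong (insert X V) P"
  obtains A B where "regular A" "\<not> A \<midarrow>Ending\<rightarrow> Done" "linear_in rcong V B"
    "prov_equiv rcong P (Sum (Seq A X) B)"
proof -
  \<comment> \<open>An unknown that does not occur gets the coefficient \<open>Zero\<close>.\<close>
  have no_X: "prov_equiv rcong P (Sum (Seq Zero X) P)" for P
    using prov_equiv_Sum[OF prov_equiv_Zero_Seq prov_equiv_refl] prov_equiv_Zero_Sum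
    by (meson prov_equiv_sym prov_equiv_trans)
  have Zero: "\<not> Zero \<midarrow>Ending\<rightarrow> Done"
    by (auto elim: step_elims)
  from assms have "\<exists>A B. regular A \<and> \<not> A \<midarrow>Ending\<rightarrow> Done \<and> linear_in rcong V B \<and>
    prov_equiv rcong P (Sum (Seq A X) B)"
  proof induction
    case (const B)
    then show ?case
      using no_X Zero by (meson linear_in.const regular_simps(1))
  next
    case (var Y A)
    show ?case
    proof (cases "Y = X")
      case True
      then show ?thesis
        using var prov_equiv_sym[OF prov_equiv_Sum_Zero] linear_in.const regular_simps(1) by blast
    next
      case False
      then show ?thesis
        using var no_X Zero by (meson insertE linear_in.var regular_simps(1))
    qed
  next
    case (sum P Q)
    then obtain A B A' B' where P: "regular A" "\<not> A \<midarrow>Ending\<rightarrow> Done" "linear_in rcong V B"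
        "prov_equiv rcong P (Sum (Seq A X) B)"
      and Q: "regular A'" "\<not> A' \<midarrow>Ending\<rightarrow> Done" "linear_in rcong V B'"
        "prov_equiv rcong Q (Sum (Seq A' X) B')"
      by blast
    have "prov_equiv rcong (Sum P Q) (Sum (Sum (Seq A X) B) (Sum (Seq A' X) B'))"
      by (intro prov_equiv_Sum P Q)
    also note prov_equiv_Sum_interchange
    also have "prov_equiv rcong (Sum (Sum (Seq A X) (Seq A' X)) (Sum B B'))
        (Sum (Seq (Sum A A') X) (Sum B B'))"
      by (intro prov_equiv_Sum prov_equiv_refl prov_equiv_sym[OF prov_equiv_Sum_Seq])
    finally have "prov_equiv rcong (Sum P Q) (Sum (Seq (Sum A A') X) (Sum B B'))" .
    moreover have "\<not> Sum A A' \<midarrow>Ending\<rightarrow> Done"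
      using P Q by (auto elim: step_elims)
    moreover have "regular (Sum A A')" "linear_in rcong V (Sum B B')"
      using P Q by (auto intro: linear_in.sum)
    ultimately show ?case by blast
  next
    case (equiv P Q)
    then show ?case by (meson prov_equiv_trans)
  qed
  then show ?thesis using that by blast
qed

text \<open>Substitution of linear forms for the unknowns; \<open>linear_in_Seq\<close> multiplies
  each by the coefficient in front of it.\<close>

lemma linear_in_eliminate:
  assumes "linear_in rcong V P" and "\<And>X. X \<in> V \<Longrightarrow> linear_in rcong W X"
  shows "linear_in rcong W P"
  using assms(1) by induction (auto intro: linear_in.intros linear_in_Seq assms(2))

lemma linear_in_empty:
  "linear_in rcong {} P \<Longrightarrow> \<exists>Q. regular Q \<and> prov_equiv rcong P Q"
  by (induction rule: linear_in.induct)
    (auto intro: prov_equiv_refl, (meson prov_equiv_Sum regular_simps prov_equiv_trans)+)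

text \<open>Gaussian elimination by induction on the set of unknowns.\<close>

lemma linear_system_solution:
  assumes "finite V" and "\<And>X. X \<in> V \<Longrightarrow> linear_in rcong V X" and "X \<in> V"
  shows "linear_in rcong {} X"
  using assms
proof (induction V arbitrary: X rule: finite_induct)
  case empty
  then show ?case by simp
next
  case (insert Y V)
  obtain A B where AB: "regular A" "\<not> A \<midarrow>Ending\<rightarrow> Done" "linear_in rcong V B"
    "prov_equiv rcong Y (Sum (Seq A Y) B)"
    by (rule linear_in_insertE[OF insert.prems(1)[OF insertI1]])
  \<comment> \<open>The solution for \<open>Y\<close> provided by \<open>Ard\<close>. That
    \<open>Star A\<close> can end does no harm, because \<open>B\<close> is already linear in
    \<open>V\<close>.\<close>
  have "linear_in rcong V (Seq (Star A) B)"
    using AB by (simp add: linear_in_Seq)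
  then have Y: "linear_in rcong V Y"
    by (rule linear_in.equiv) (rule prov_equiv_Ard[OF AB(4,2)])
  \<comment> \<open>Substituting the solution for \<open>Y\<close> leaves a system in the unknowns
    \<open>V\<close> alone.\<close>
  have V: "linear_in rcong V Z" if ZV: "Z \<in> V" for Z
  proof -
    obtain A' B' where Z: "regular A'" "linear_in rcong V B'"
      "prov_equiv rcong Z (Sum (Seq A' Y) B')"
      by (rule linear_in_insertE[OF insert.prems(1)[OF insertI2[OF ZV]]])
    show ?thesis
      by (rule linear_in.equiv[OF linear_in.sum[OF linear_in_Seq[OF Y Z(1)] Z(2)] Z(3)])
  qed
  have "linear_in rcong {} Z" if "Z \<in> V" for Z
    using insert.IH V that by blast
  \<comment> \<open>Back substitution of the solved unknowns into the equation for
    \<open>Y\<close>.\<close>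
  with Y have "linear_in rcong {} Y"
    by (rule linear_in_eliminate)
  with \<open>X \<in> insert Y V\<close> insert.IH V show ?case by blast
qed


section \<open>Derivatives and expansion\<close>

text \<open>As for the partial derivatives of a regular expression, \<open>Seq P Q\<close> evolves into
  \<open>Seq P' Q\<close> or into a derivative of \<open>Q\<close>, and \<open>Star P\<close> only into \<open>Seq P' (Star P)\<close>.\<close>

lemma finite_derivatives:
  assumes "regular P"
  shows "\<exists>D. finite D \<and> P \<in> D \<and> (\<forall>Q\<in>D. regular Q \<and> (\<forall>\<alpha> Q'. Q \<midarrow>Act \<alpha>\<rightarrow> Proc Q' \<longrightarrow> Q' \<in> D))"
  using assms
proof (induction P)
  case Zero
  show ?case by (rule exI[of _ "{Zero}"]) (auto elim: step_elims)
next
  case END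
  show ?case by (rule exI[of _ "{END}"]) (auto elim: step_elims)
next
  case (Pre \<alpha> P)
  then obtain D where "finite D" "P \<in> D"
    "\<forall>Q\<in>D. regular Q \<and> (\<forall>\<alpha> Q'. Q \<midarrow>Act \<alpha>\<rightarrow> Proc Q' \<longrightarrow> Q' \<in> D)"
    by auto
  then show ?case
    by (intro exI[of _ "insert (Pre \<alpha> P) D"]) (auto elim: step_elims)
next
  case (Seq P R)
  then obtain D E where D: "finite D" "P \<in> D"
      "\<forall>Q\<in>D. regular Q \<and> (\<forall>\<alpha> Q'. Q \<midarrow>Act \<alpha>\<rightarrow> Proc Q' \<longrightarrow> Q' \<in> D)"
    and E: "finite E" "R \<in> E"
      "\<forall>Q\<in>E. regular Q \<and> (\<forall>\<alpha> Q'. Q \<midarrow>Act \<alpha>\<rightarrow> Proc Q' \<longrightarrow> Q' \<in> E)"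
    by auto
  then show ?case
    by (intro exI[of _ "(\<lambda>P'. Seq P' R) ` D \<union> E"]) (auto elim!: step_elims(5))
next
  case (Sum P R)
  then obtain D E where "finite D" "P \<in> D"
      "\<forall>Q\<in>D. regular Q \<and> (\<forall>\<alpha> Q'. Q \<midarrow>Act \<alpha>\<rightarrow> Proc Q' \<longrightarrow> Q' \<in> D)"
    and "finite E" "R \<in> E"
      "\<forall>Q\<in>E. regular Q \<and> (\<forall>\<alpha> Q'. Q \<midarrow>Act \<alpha>\<rightarrow> Proc Q' \<longrightarrow> Q' \<in> E)"
    by auto
  then show ?case
    by (intro exI[of _ "insert (Sum P R) (D \<union> E)"]) (auto elim: step_elims)
next
  case (Star P)
  then obtain D where "finite D" "P \<in> D"
    "\<forall>Q\<in>D. regular Q \<and> (\<forall>\<alpha> Q'. Q \<midarrow>Act \<alpha>\<rightarrow> Proc Q' \<longrightarrow> Q' \<in> D)"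
    by auto
  \<comment> \<open>When \<open>P'\<close> ends, \<open>Seq P' (Star P)\<close> takes a step of
    \<open>Star P\<close>, which leads back into the same image of \<open>D\<close>.\<close>
  then show ?case
    using Star.prems
    by (intro exI[of _ "insert (Star P) ((\<lambda>P'. Seq P' (Star P)) ` D)"])
      (auto elim!: step_elims(5,7))
qed (simp_all add: regular_def)

lemma linear_in_set_sum:
  assumes "finite A" and "\<And>P. P \<in> A \<Longrightarrow> linear_in rcong V P"
  shows "linear_in rcong V (set_sum A)"
proof -
  have "\<exists>Ps. distinct Ps \<and> set Ps = A"
    using finite_distinct_list[OF assms(1)] by blast
  then have A: "set (SOME Ps. distinct Ps \<and> set Ps = A) = A"
    by (rule someI2_ex) simp
  \<comment> \<open>The chosen enumeration is unknown, so the claim is proved for every list over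
    \<open>A\<close>.\<close>
  have "linear_in rcong V (foldr Sum Ps Zero)" if "set Ps \<subseteq> A" for Ps
    using that by (induction Ps) (auto intro: linear_in.const linear_in.sum assms(2))
  then show ?thesis
    unfolding set_sum_def using A by blast
qed

text \<open>The coefficient is \<open>Pre \<alpha> END\<close>, which cannot end: the guardedness
  required by \<open>Ard\<close> comes from the prefixes in the expansion.\<close>

lemma linear_in_Pre: "X \<in> V \<Longrightarrow> linear_in rcong V (Pre \<alpha> X)"
  by (rule linear_in.equiv[OF linear_in.var prov_equiv_Pre_Seq]) (auto elim: step_elims)

lemma linear_in_Exp:
  assumes 1: "\<And>\<alpha> P'. P \<midarrow>Act \<alpha>\<rightarrow> Proc P' \<Longrightarrow> Par P' Q \<in> V"
    and 2: "\<And>\<alpha> Q'. Q \<midarrow>Act \<alpha>\<rightarrow> Proc Q' \<Longrightarrow> Par P Q' \<in> V"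
    and 3: "\<And>\<alpha> \<beta> P' Q'. P \<midarrow>Act \<alpha>\<rightarrow> Proc P' \<Longrightarrow> Q \<midarrow>Act \<beta>\<rightarrow> Proc Q' \<Longrightarrow> Par P' Q' \<in> V"
  shows "linear_in rcong V (Exp P Q)"
proof -
  let ?S = "\<lambda>P. {(\<alpha>, P'). P \<midarrow>Act \<alpha>\<rightarrow> Proc P'}"
  have "{Pre \<alpha> (Par P' Q) | \<alpha> P'. P \<midarrow>Act \<alpha>\<rightarrow> Proc P'} = (\<lambda>(\<alpha>, P'). Pre \<alpha> (Par P' Q)) ` ?S P"
    by auto
  then have fin1: "finite {Pre \<alpha> (Par P' Q) | \<alpha> P'. P \<midarrow>Act \<alpha>\<rightarrow> Proc P'}"
    using finite_step[of P] by simp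
  have "{Pre \<alpha> (Par P Q') | \<alpha> Q'. Q \<midarrow>Act \<alpha>\<rightarrow> Proc Q'} = (\<lambda>(\<alpha>, Q'). Pre \<alpha> (Par P Q')) ` ?S Q"
    by auto
  then have fin2: "finite {Pre \<alpha> (Par P Q') | \<alpha> Q'. Q \<midarrow>Act \<alpha>\<rightarrow> Proc Q'}"
    using finite_step[of Q] by simp
  \<comment> \<open>For finiteness it suffices to bound the complementary pairs by all pairs of
    steps.\<close>
  have "{Pre Tau (Par P' Q') | \<alpha> P' Q'. \<alpha> \<noteq> Tau \<and> P \<midarrow>Act \<alpha>\<rightarrow> Proc P' \<and>
      Q \<midarrow>Act (compl \<alpha>)\<rightarrow> Proc Q'} \<subseteq> (\<lambda>(x, y). Pre Tau (Par (snd x) (snd y))) ` (?S P \<times> ?S Q)"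
    by force
  then have fin3: "finite {Pre Tau (Par P' Q') | \<alpha> P' Q'. \<alpha> \<noteq> Tau \<and> P \<midarrow>Act \<alpha>\<rightarrow> Proc P' \<and>
      Q \<midarrow>Act (compl \<alpha>)\<rightarrow> Proc Q'}"
    by (rule finite_subset) (intro finite_imageI finite_cartesian_product finite_step)
  show ?thesis
    unfolding Exp_def
    by (intro linear_in.sum linear_in_set_sum fin1 fin2 fin3)
      (auto intro: linear_in.const intro!: linear_in_Pre 1 2 3)
qed

text \<open>The unknowns are all compositions of a derivative of \<open>P\<close> with one of
  \<open>Q\<close>. This finite set is closed under steps, and \<open>PC\<close> equates each member
  with its expansion, which is linear in the set.\<close>

lemma Par_regular:
  assumes "regular P" and "regular Q"
  shows "\<exists>R. regular R \<and> prov_equiv rcong (Par P Q) R"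
proof -
  obtain D where D: "finite D" "P \<in> D"
    "\<And>P'. P' \<in> D \<Longrightarrow> regular P'" "\<And>P' \<alpha> P''. P' \<in> D \<Longrightarrow> P' \<midarrow>Act \<alpha>\<rightarrow> Proc P'' \<Longrightarrow> P'' \<in> D"
    using finite_derivatives[OF assms(1)] by blast
  obtain E where E: "finite E" "Q \<in> E"
    "\<And>Q'. Q' \<in> E \<Longrightarrow> regular Q'" "\<And>Q' \<alpha> Q''. Q' \<in> E \<Longrightarrow> Q' \<midarrow>Act \<alpha>\<rightarrow> Proc Q'' \<Longrightarrow> Q'' \<in> E"
    using finite_derivatives[OF assms(2)] by blast
  define V where "V = (\<lambda>(P', Q'). Par P' Q') ` (D \<times> E)"
  have V: "Par P' Q' \<in> V" if "P' \<in> D" "Q' \<in> E" for P' Q'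
    using that by (auto simp: V_def)
  have "linear_in rcong V X" if XV: "X \<in> V" for X
  proof -
    obtain P' Q' where X: "X = Par P' Q'" "P' \<in> D" "Q' \<in> E"
      using XV by (auto simp: V_def)
    have "linear_in rcong V (Exp P' Q')"
      by (rule linear_in_Exp) (use V D(4) E(4) X in blast)+
    moreover have "prov_equiv rcong X (Exp P' Q')"
      using D(3)[OF X(2)] E(3)[OF X(3)]
      by (simp add: X(1) prov_equiv_def regular_def derivable.PC)
    ultimately show ?thesis
      by (rule linear_in.equiv)
  qed
  moreover have "finite V"
    using D(1) E(1) by (simp add: V_def)
  ultimately have "linear_in rcong {} (Par P Q)"
    using linear_system_solution V D(2) E(2) by blast
  then show ?thesis
    by (rule linear_in_empty)
qed

text \<open>\<open>PC\<close> needs components without \<open>Par\<close>. The induction therefore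
  first replaces both components by regular ones, using congruence, and then applies
  \<open>Par_regular\<close>.\<close>

lemma unrestricted_regular:
  "unrestricted P \<Longrightarrow> \<exists>Q. regular Q \<and> prov_equiv rcong P Q"
proof (induction P)
  case Zero
  show ?case using prov_equiv_refl regular_simps by blast
next
  case END
  show ?case using prov_equiv_refl regular_simps by blast
next
  case (Pre \<alpha> P)
  then show ?case by (metis prov_equiv_Pre regular_simps(3) unrestricted.simps(3))
next
  case (Seq P Q)
  then show ?case by (metis prov_equiv_Seq regular_simps(4) unrestricted.simps(4))
next
  case (Sum P Q)
  then show ?case by (metis prov_equiv_Sum regular_simps(5) unrestricted.simps(5))
next
  case (Par P Q)
  then show ?case
    by (metis prov_equiv_Par prov_equiv_trans Par_regular unrestricted.simps(6))
next
  case (Star P)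
  then show ?case by (metis prov_equiv_Star regular_simps(6) unrestricted.simps(7))
qed simp

theorem theorem5p19:
  fixes rcong :: "'a proc \<Rightarrow> 'a proc \<Rightarrow> bool" and P P1 P2 :: "'a proc"
  assumes "P = Par P1 P2" and "unrestricted P"
  shows "\<exists>P'. par_free P' \<and> prov_equiv rcong P P'"
  using unrestricted_regular[OF assms(2)] by (auto simp: regular_def)

end
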